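(* Let $(X,d,\preceq)$ be an ordered metric space, $F:X^n\to X$ a mapping and $\ast\in\mathfrak B_n$. Let $E$ be an $\mathrm O$-complete subspace of $X$ such that $F(X^n)\subseteq E$. Suppose that the following conditions hold: (i) $F$ has the monotone property; (ii) either $F$ is $\mathrm O$-continuous or $(E,d,\preceq)$ has the MCB property; (iii$''$) there exist $x^{(0)}_1,\dots,x^{(0)}_n\in X$ such that either $x^{(0)}_i\preceq F(x^{(0)}_{i_1},\dots,x^{(0)}_{i_n})$ for each $i\in I_n$, or $x^{(0)}_i\succeq F(x^{(0)}_{i_1},\dots,x^{(0)}_{i_n})$ for each $i\in I_n$; (iv) there exists $\varphi\in\Omega$ such that $$\frac1n\sum_{i=1}^n d\big(F(x_{i_1},\dots,x_{i_n}),F(y_{i_1},\dots,y_{i_n})\big)\le\varphi\Big(\frac1n\sum_{i=1}^n d(x_i,y_i)\Big)$$ for all $x_1,\dots,x_n,y_1,\dots,y_n\in X$ with [$x_i\preceq y_i$ for each $i\in I_n$] or [$x_i\succeq y_i$ for each $i\in I_n$]; or, alternatively to (iv), (iv$'$) there exists $\varphi\in\Omega$ such that $$\max_{i\in I_n} d\big(F(x_{i_1},\dots,x_{i_n}),F(y_{i_1},\dots,y_{i_n})\big)\le\varphi\Big(\max_{i\in I_n} d(x_i,y_i)\Big)$$ for all $x_1,\dots,x_n,y_1,\dots,y_n\in X$ with [$x_i\preceq y_i$ for each $i\in I_n$] or [$x_i\succeq y_i$ for each $i\in I_n$]. Then $F$ has an $\ast$-fixed point.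
   Context: Throughout, $n\ge 2$ is a fixed integer, $I_n=\{1,\dots,n\}$, and sequences are indexed by $m\in\mathbb N_0$. An ordered metric space $(X,d,\preceq)$ is a nonempty set $X$ with a metric $d$ and a partial order $\preceq$; $x\succeq y$ means $y\preceq x$. A subspace is a nonempty subset with the restricted metric and order. $\mathfrak B_n$ is the set of all binary operations $\ast:I_n\times I_n\to I_n$; for $\ast\in\mathfrak B_n$ write $i_k:=\ast(i,k)$. A sequence $\{x^{(m)}\}$ is increasing (decreasing) if $x^{(m)}\preceq x^{(m+1)}$ (resp. $x^{(m)}\succeq x^{(m+1)}$) for all $m$, and monotone if it is increasing or decreasing. $x^{(m)}\uparrow x$, $x^{(m)}\downarrow x$, $x^{(m)}\uparrow\downarrow x$ mean that $\{x^{(m)}\}$ converges to $x$ in $d$ and is, respectively, increasing, decreasing, monotone. $E$ is $\mathrm O$-complete if every monotone Cauchy sequence in $E$ converges in $E$. $F$ is $\mathrm O$-continuous if for every $(x_1,\dots,x_n)\in X^n$ and all sequences $\{x_1^{(m)}\},\dots,\{x_n^{(m)}\}$ in $X$ with $x_i^{(m)}\uparrow\downarrow x_i$ for each $i$, one has $F(x_1^{(m)},\dots,x_n^{(m)})\to F(x_1,\dots,x_n)$. $(E,d,\preceq)$ has the MCB property if for every sequence $\{x^{(m)}\}$ in $E$ and $x\in E$: $x^{(m)}\uparrow x$ implies $x^{(m)}\preceq x$ for all $m$, and $x^{(m)}\downarrow x$ implies $x^{(m)}\succeq x$ for all $m$. $F$ has the monotone property if, for all $x_1,\dots,x_n,y_1,\dots,y_n\in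 X$, $x_i\preceq y_i$ for all $i\in I_n$ implies $F(x_1,\dots,x_n)\preceq F(y_1,\dots,y_n)$. $\Omega$ is the set of functions $\varphi:[0,\infty)\to[0,\infty)$ with $\varphi(t)<t$ and $\limsup_{r\to t^+}\varphi(r)<t$ for each $t>0$. $(x_1,\dots,x_n)\in X^n$ is an $\ast$-fixed point of $F$ if $F(x_{i_1},\dots,x_{i_n})=x_i$ for each $i\in I_n$. *)

theory Defs
  imports "HOL-Analysis.Analysis"
begin

text \<open>
  An ordered metric space is a type of class \<open>{metric_space, order}\<close>; no compatibility between
  metric and order is imposed. A subspace is a nonempty set \<open>E\<close> with the inherited metric and order.
  The index set \<open>I\<^sub>n\<close> is a finite type \<open>'n\<close> with \<open>n = CARD('n)\<close>, the power \<open>X\<^sup>n\<close> is \<open>'a ^ 'n\<close>,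
  and a binary operation on \<open>I\<^sub>n\<close> is a function \<open>'n \<Rightarrow> 'n \<Rightarrow> 'n\<close>.
\<close>

text \<open>The tuple \<open>(x\<^bsub>i\<^sub>1\<^esub>, \<dots>, x\<^bsub>i\<^sub>n\<^esub>)\<close>, where \<open>i\<^sub>k = star i k\<close>.\<close>

definition star_tuple :: "('n \<Rightarrow> 'n \<Rightarrow> 'n) \<Rightarrow> 'n \<Rightarrow> 'a ^ 'n \<Rightarrow> 'a ^ 'n" where
  "star_tuple star i x = (\<chi> k. x $ star i k)"

definition star_fixed_point :: "('n \<Rightarrow> 'n \<Rightarrow> 'n) \<Rightarrow> ('a ^ 'n \<Rightarrow> 'a) \<Rightarrow> 'a ^ 'n \<Rightarrow> bool" where
  "star_fixed_point star F x \<longleftrightarrow> (\<forall>i. F (star_tuple star i x) = x $ i)"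

definition monotone_property :: "('a::order ^ 'n \<Rightarrow> 'a) \<Rightarrow> bool" where
  "monotone_property F \<longleftrightarrow> (\<forall>x y. (\<forall>i. x $ i \<le> y $ i) \<longrightarrow> F x \<le> F y)"

definition O_complete :: "'a::{metric_space, order} set \<Rightarrow> bool" where
  "O_complete E \<longleftrightarrow>
     (\<forall>u::nat \<Rightarrow> 'a. (\<forall>m. u m \<in> E) \<and> (incseq u \<or> decseq u) \<and> Cauchy u
        \<longrightarrow> (\<exists>l\<in>E. u \<longlonglongrightarrow> l))"

text \<open>The coordinate sequences may be monotone in different directions.\<close>

definition O_continuous :: "('a::{metric_space, order} ^ 'n \<Rightarrow> 'a) \<Rightarrow> bool" where
  "O_continuous F \<longleftrightarrow>
     (\<forall>(x::'a ^ 'n) (u::'n \<Rightarrow> nat \<Rightarrow> 'a).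
        (\<forall>i. (incseq (u i) \<or> decseq (u i)) \<and> u i \<longlonglongrightarrow> x $ i)
        \<longrightarrow> (\<lambda>m. F (\<chi> i. u i m)) \<longlonglongrightarrow> F x)"

definition MCB_property :: "'a::{metric_space, order} set \<Rightarrow> bool" where
  "MCB_property E \<longleftrightarrow>
     (\<forall>(u::nat \<Rightarrow> 'a) x. (\<forall>m. u m \<in> E) \<and> x \<in> E \<and> u \<longlonglongrightarrow> x \<longrightarrow>
        (incseq u \<longrightarrow> (\<forall>m. u m \<le> x)) \<and> (decseq u \<longrightarrow> (\<forall>m. u m \<ge> x)))"

text \<open>
  Functions \<open>[0,\<infinity>) \<Rightarrow> [0,\<infinity>)\<close> are represented by functions on the reals whose values at negative
  arguments are irrelevant. The upper limit is taken in the extended reals, since \<open>Limsup\<close>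
  requires a complete lattice.
\<close>

definition Omega :: "(real \<Rightarrow> real) set" where
  "Omega = {\<phi>. (\<forall>t\<ge>0. \<phi> t \<ge> 0) \<and>
     (\<forall>t>0. \<phi> t < t \<and> Limsup (at_right t) (\<lambda>r. ereal (\<phi> r)) < ereal t)}"

end

theory Submission
  imports Defs
begin

text \<open>
  The tuple \<open>x\<close> is a \<open>\<ast>\<close>-fixed point of \<open>F\<close> exactly when it is a fixed point of the map
  \<open>G x = (F (x\<^bsub>1\<^sub>1\<^esub>, \<dots>), \<dots>, F (x\<^bsub>n\<^sub>1\<^esub>, \<dots>))\<close> of the product into itself, called \<open>star_map\<close> below.
  The monotone property of \<open>F\<close> makes \<open>G\<close> monotone for the componentwise order, and either form of
  the contraction condition says that \<open>G\<close> is a Boyd--Wong contraction on comparable pairs, for the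
  average or for the maximum of the coordinate distances. Both aggregates are distances compatible
  with the coordinates, and only this is used (\<open>product_distance\<close>), so that the two conditions are
  treated together.

  Iterating \<open>G\<close> from the given starting tuple produces an orbit which is monotone, in one common
  direction for all coordinates; hence any two of its terms are comparable, and the contraction
  forces the orbit to be Cauchy (\<open>Cauchy_if_gap_contraction\<close>). From its second term on the orbit
  lives in \<open>E\<close>, so each coordinate converges by \<open>O\<close>-completeness. The limit is fixed: under
  \<open>O\<close>-continuity because one may pass to the limit in \<open>z\<^bsub>m+1\<^esub> = G z\<^sub>m\<close>, and under the MCB property
  because the limit \<open>l\<close> is then comparable to the orbit, so that \<open>G\<close> does not increase the distances
  \<open>D z\<^sub>m l\<close> and \<open>G z\<^sub>m\<close> tends to \<open>G l\<close>.
\<close>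

section \<open>Boyd--Wong contractions along an orbit\<close>

text \<open>
  The upper limit controls \<open>\<phi>\<close> strictly to the right of \<open>t\<close> and the inequality \<open>\<phi> t < t\<close> controls
  it at \<open>t\<close>; together they give a single bound \<open>q < t\<close> on some interval \<open>[t, t + \<delta>)\<close>. In this form
  the control function can be applied to distances that approach \<open>t\<close> from above.
\<close>

lemma Omega_uniform_gap:
  assumes "\<phi> \<in> Omega" and "t > 0"
  obtains \<delta> q where "\<delta> > 0" "q < t" "\<And>r. t \<le> r \<Longrightarrow> r < t + \<delta> \<Longrightarrow> \<phi> r \<le> q"
proof -
  have at: "\<phi> t < t" and lim: "Limsup (at_right t) (\<lambda>r. ereal (\<phi> r)) < ereal t"
    using assms by (auto simp: Omega_def)
  obtain q where q: "Limsup (at_right t) (\<lambda>r. ereal (\<phi> r)) < ereal q" "q < t"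
    using ereal_dense2[OF lim] by auto
  have "eventually (\<lambda>r. ereal (\<phi> r) < ereal q) (at_right t)"
    using q(1) by (rule Limsup_lessD)
  then obtain b where b: "b > t" "\<And>r. t < r \<Longrightarrow> r < b \<Longrightarrow> \<phi> r < q"
    unfolding eventually_at_right_field by auto
  show thesis
  proof (rule that)
    show "b - t > 0" using b(1) by simp
    show "max q (\<phi> t) < t" using q(2) at by simp
    show "\<phi> r \<le> max q (\<phi> t)" if "t \<le> r" "r < t + (b - t)" for r
      using b(2)[of r] that by (cases "r = t") auto
  qed
qed

text \<open>
  The Boyd--Wong argument, in terms of the distances \<open>e m k\<close> between the terms of an orbit. The
  consecutive distances decrease, and a positive limit \<open>c\<close> is impossible, since a distance in
  \<open>[c, c + \<delta>)\<close> would be followed by one below \<open>c\<close>. Now let \<open>t > 0\<close> and let \<open>m\<close> be so large that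
  the steps are small compared to \<open>\<delta>\<close> and \<open>t - q\<close>. Then the orbit from \<open>m\<close> on cannot leave the ball
  of radius \<open>t + \<delta>\<close> about its \<open>m\<close>-th term: passing to the successors of both points does not increase
  their distance, and a distance of at least \<open>t\<close> is pulled down to \<open>q < t\<close>, so that adding the step
  from \<open>m\<close> to \<open>m + 1\<close> does not lead out of the ball.
\<close>

lemma Cauchy_if_gap_contraction:
  fixes e :: "nat \<Rightarrow> nat \<Rightarrow> real"
  assumes nonneg: "\<And>m k. e m k \<ge> 0"
    and refl: "\<And>m. e m m = 0"
    and triangle: "\<And>l m k. e l k \<le> e l m + e m k"
    and nonexp: "\<And>m k. e (Suc m) (Suc k) \<le> e m k"
    and gap: "\<And>t. t > 0 \<Longrightarrow> \<exists>\<delta>>0. \<exists>q<t. \<forall>m k. t \<le> e m k \<and> e m k < t + \<delta> \<longrightarrow> e (Suc m) (Suc k) \<le> q"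
    and "\<epsilon> > 0"
  shows "\<exists>N. \<forall>m\<ge>N. \<forall>k. e m (m + k) < \<epsilon>"
proof -
  define c where "c m = e m (Suc m)" for m
  have dec: "decseq c"
    by (rule decseq_SucI) (simp add: c_def nonexp)
  obtain L where L: "c \<longlonglongrightarrow> L" "\<And>m. L \<le> c m"
    using decseq_convergent[OF dec, of 0] nonneg by (auto simp: c_def)
  have "L = 0"
  proof (rule ccontr)
    assume "L \<noteq> 0"
    moreover have "L \<ge> 0"
      using L(1) by (rule LIMSEQ_le_const) (simp add: c_def nonneg)
    ultimately obtain \<delta> q where \<delta>: "\<delta> > 0" "q < L"
      and q: "\<And>m k. L \<le> e m k \<Longrightarrow> e m k < L + \<delta> \<Longrightarrow> e (Suc m) (Suc k) \<le> q"
      using gap[of L] by (metis less_eq_real_def)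
    obtain m where "c m < L + \<delta>"
      using order_tendstoD(2)[OF L(1), of "L + \<delta>"] \<delta>(1) by (auto simp: eventually_sequentially)
    then have "c (Suc m) \<le> q"
      using q[of m "Suc m"] L(2)[of m] by (simp add: c_def)
    then show False
      using L(2)[of "Suc m"] \<delta>(2) by simp
  qed
  \<comment> \<open>Half of \<open>\<epsilon>\<close>, because the orbit is only confined to the slightly larger radius \<open>t + \<eta>\<close>.\<close>
  define t where "t = \<epsilon> / 2"
  have t: "t > 0" using \<open>\<epsilon> > 0\<close> by (simp add: t_def)
  obtain \<delta> q where \<delta>: "\<delta> > 0" "q < t"
    and q: "\<And>m k. t \<le> e m k \<Longrightarrow> e m k < t + \<delta> \<Longrightarrow> e (Suc m) (Suc k) \<le> q"
    using gap[OF t] by metis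
  define \<eta> where "\<eta> = min \<delta> t"
  have \<eta>: "\<eta> > 0" "\<eta> \<le> \<delta>" "\<eta> \<le> t" using \<delta> t by (auto simp: \<eta>_def)
  obtain N where N: "\<And>m. m \<ge> N \<Longrightarrow> c m < min \<eta> (t - q)"
    using order_tendstoD(2)[OF L(1), of "min \<eta> (t - q)"] \<open>L = 0\<close> \<eta>(1) \<delta>(2)
    by (auto simp: eventually_sequentially)
  have "e m (m + k) < t + \<eta>" if m: "m \<ge> N" for m k
  proof (induction k)
    case 0
    then show ?case using refl t \<eta>(1) by simp
  next
    case (Suc k)
    have step: "e m (m + Suc k) \<le> c m + e (Suc m) (Suc (m + k))"
      using triangle[of m "m + Suc k" "Suc m"] by (simp add: c_def)
    show ?case
    proof (cases "t \<le> e m (m + k)")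
      case True
      then have "e (Suc m) (Suc (m + k)) \<le> q"
        using q Suc \<eta>(2) by simp
      then show ?thesis using step N[OF m] \<eta>(1) by simp
    next
      case False
      then show ?thesis
        using step N[OF m] nonexp[of m "m + k"] by simp
    qed
  qed
  then show ?thesis
    using \<eta>(3) by (smt (verit) field_sum_of_halves t_def)
qed

section \<open>The map on the product and its distances\<close>

definition star_map :: "('n \<Rightarrow> 'n \<Rightarrow> 'n) \<Rightarrow> ('a ^ 'n \<Rightarrow> 'a) \<Rightarrow> 'a ^ 'n \<Rightarrow> 'a ^ 'n" where
  "star_map star F x = (\<chi> i. F (star_tuple star i x))"

lemma star_map_nth [simp]: "star_map star F x $ i = F (star_tuple star i x)"
  by (simp add: star_map_def)

text \<open>
  What the average and the maximum of the coordinate distances have in common. The two comparisons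
  say that convergence for \<open>D\<close> is coordinatewise convergence; that \<open>D\<close> separates points and vanishes
  on the diagonal follows from them.
\<close>

definition product_distance :: "('a::metric_space ^ 'n \<Rightarrow> 'a ^ 'n \<Rightarrow> real) \<Rightarrow> bool" where
  "product_distance D \<longleftrightarrow>
     (\<forall>x y. D x y \<ge> 0) \<and>
     (\<forall>x y z. D x z \<le> D x y + D y z) \<and>
     (\<forall>x y. D x y \<le> (\<Sum>i\<in>UNIV. dist (x $ i) (y $ i))) \<and>
     (\<exists>C>0. \<forall>x y i. dist (x $ i) (y $ i) \<le> C * D x y)"

lemma product_distance_average:
  "product_distance (\<lambda>x y :: 'a::metric_space ^ 'n::finite.
     1 / real CARD('n) * (\<Sum>i\<in>UNIV. dist (x $ i) (y $ i)))"
proof -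
  have n: "real CARD('n) \<ge> 1"
    using zero_less_card_finite[where 'a='n] by linarith
  have "1 / real CARD('n) * S \<le> S" if "S \<ge> 0" for S
    using that n by (simp add: field_simps mult_le_cancel_left1)
  moreover have "dist (x $ i) (y $ i) \<le> (\<Sum>i\<in>UNIV. dist (x $ i) (y $ i))" for x y :: "'a ^ 'n" and i
    by (rule member_le_sum) auto
  moreover have "(\<Sum>i\<in>UNIV. dist (x $ i) (z $ i))
      \<le> (\<Sum>i\<in>UNIV. dist (x $ i) (y $ i)) + (\<Sum>i\<in>UNIV. dist (y $ i) (z $ i))" for x y z :: "'a ^ 'n"
    by (simp add: sum.distrib[symmetric] dist_triangle sum_mono)
  ultimately show ?thesis
    unfolding product_distance_def using n
    by (auto simp: sum_nonneg add_divide_distrib[symmetric] divide_right_mono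
        intro!: exI[of _ "real CARD('n)"])
qed

lemma product_distance_maximum:
  "product_distance (\<lambda>x y :: 'a::metric_space ^ 'n::finite. MAX i\<in>UNIV. dist (x $ i) (y $ i))"
proof -
  define M where "M x y = (MAX i\<in>UNIV. dist (x $ i) (y $ i))" for x y :: "'a ^ 'n"
  have upper: "dist (x $ i) (y $ i) \<le> M x y" for x y i
    by (simp add: M_def)
  have least: "M x y \<le> b" if "\<And>i. dist (x $ i) (y $ i) \<le> b" for x y b
    using that by (simp add: M_def)
  have "M x y \<ge> 0" for x y
    using upper[of x undefined y] order_trans zero_le_dist by blast
  moreover have "M x z \<le> M x y + M y z" for x y z
    by (rule least) (meson add_mono dist_triangle order_trans upper)
  moreover have "M x y \<le> (\<Sum>i\<in>UNIV. dist (x $ i) (y $ i))" for x y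
    by (rule least, rule member_le_sum) auto
  ultimately show ?thesis
    unfolding product_distance_def M_def[symmetric]
    using upper by (auto intro!: exI[of _ 1])
qed

text \<open>
  Only \<open>\<phi> 0 \<ge> 0\<close> is known at \<open>0\<close>, so the inequality \<open>\<phi> t < t\<close> gives nothing for pairs at distance
  \<open>0\<close>; for these, \<open>D\<close> separating points and vanishing on the diagonal settles the claim.
\<close>

lemma Omega_contraction_nonexpansive:
  assumes D: "product_distance D" and "\<phi> \<in> Omega" and "D (G x) (G y) \<le> \<phi> (D x y)"
  shows "D (G x) (G y) \<le> D x y"
proof (cases "D x y = 0")
  case True
  obtain C where "\<And>i. dist (x $ i) (y $ i) \<le> C * D x y"
    using D unfolding product_distance_def by blast
  then have "x = y" using True by (simp add: vec_eq_iff)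
  moreover have "D (G x) (G x) \<le> (\<Sum>i\<in>UNIV. dist (G x $ i) (G x $ i))"
    using D unfolding product_distance_def by blast
  ultimately show ?thesis using True by simp
next
  case False
  then have "D x y > 0" using D by (metis product_distance_def less_eq_real_def)
  then show ?thesis using assms(2,3) by (fastforce simp: Omega_def)
qed

section \<open>Existence of fixed points\<close>

text \<open>
  The Picard orbit of \<open>x0\<close> is monotone for the componentwise order, so the contraction applies to
  any two of its terms. The two directions of the order enter the argument symmetrically, and the
  disjunction of them is carried along instead of duplicating the proof for the dual order.
\<close>

lemma star_map_has_fixed_point:
  fixes F :: "'a::{metric_space, order} ^ 'n::finite \<Rightarrow> 'a"
    and star :: "'n \<Rightarrow> 'n \<Rightarrow> 'n"
  defines "G \<equiv> star_map star F"
  assumes complete: "O_complete E" and range: "range F \<subseteq> E"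
    and mono: "monotone_property F"
    and cont: "O_continuous F \<or> MCB_property E"
    and start: "x0 \<le> G x0 \<or> x0 \<ge> G x0"
    and D: "product_distance D" and \<phi>: "\<phi> \<in> Omega"
    and contraction: "\<And>x y. x \<le> y \<or> x \<ge> y \<Longrightarrow> D (G x) (G y) \<le> \<phi> (D x y)"
  shows "\<exists>x. G x = x"
proof -
  have G_mono: "G x \<le> G y" if "x \<le> y" for x y
    using mono that unfolding monotone_property_def G_def
    by (simp add: star_tuple_def less_eq_vec_def)
  have nonexp: "D (G x) (G y) \<le> D x y" if "x \<le> y \<or> x \<ge> y" for x y
    using Omega_contraction_nonexpansive[OF D \<phi> contraction[OF that]] .
  have D_nonneg: "D x y \<ge> 0" and D_triangle: "D x y' \<le> D x y + D y y'"
    and D_le: "D x y \<le> (\<Sum>i\<in>UNIV. dist (x $ i) (y $ i))" for x y y'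
    using D unfolding product_distance_def by blast+
  obtain C where C: "C > 0" "\<And>x y i. dist (x $ i) (y $ i) \<le> C * D x y"
    using D unfolding product_distance_def by blast

  define z where "z m = (G ^^ m) x0" for m
  have z_Suc: "z (Suc m) = G (z m)" for m by (simp add: z_def)
  have z_step: "F (star_tuple star i (z m)) = z (Suc m) $ i" for i m
    by (simp add: z_Suc G_def)
  have orbit: "incseq z \<or> decseq z"
    using start
  proof
    assume "x0 \<le> G x0"
    then have "z m \<le> z (Suc m)" for m
      by (induction m) (simp_all add: z_def G_mono)
    then show ?thesis by (simp add: incseq_SucI)
  next
    assume "x0 \<ge> G x0"
    then have "z m \<ge> z (Suc m)" for m
      by (induction m) (simp_all add: z_def G_mono)
    then show ?thesis by (simp add: decseq_SucI)
  qed
  have z_comparable: "z m \<le> z k \<or> z m \<ge> z k" for m k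
    using orbit linear[of m k] unfolding incseq_def decseq_def by blast
  have orbit_nth: "incseq (\<lambda>m. z (f m) $ i) \<or> decseq (\<lambda>m. z (f m) $ i)" if "mono f" for f i
    using orbit that by (auto simp: monotone_def less_eq_vec_def)

  have small: "\<exists>N. \<forall>m\<ge>N. \<forall>k. D (z m) (z (m + k)) < \<epsilon>" if "\<epsilon> > 0" for \<epsilon>
  proof (rule Cauchy_if_gap_contraction[where e = "\<lambda>m k. D (z m) (z k)"])
    show "D (z m) (z m) = 0" for m
      using D_le[of "z m" "z m"] D_nonneg[of "z m" "z m"] by simp
    show "\<exists>\<delta>>0. \<exists>q<t. \<forall>m k. t \<le> D (z m) (z k) \<and> D (z m) (z k) < t + \<delta> \<longrightarrow>
        D (z (Suc m)) (z (Suc k)) \<le> q" if t: "t > 0" for t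
    proof -
      obtain \<delta> q where "\<delta> > 0" "q < t" "\<And>r. t \<le> r \<Longrightarrow> r < t + \<delta> \<Longrightarrow> \<phi> r \<le> q"
        using Omega_uniform_gap[OF \<phi> t] by blast
      then show ?thesis
        using contraction[OF z_comparable] unfolding z_Suc by (meson order_trans)
    qed
    show "D (z (Suc m)) (z (Suc k)) \<le> D (z m) (z k)" for m k
      unfolding z_Suc by (rule nonexp[OF z_comparable])
  qed (rule D_nonneg D_triangle that)+
  have cauchy: "Cauchy (\<lambda>m. z m $ i)" for i
  proof (rule CauchyI')
    fix \<epsilon> :: real
    assume "\<epsilon> > 0"
    then obtain N where N: "\<And>m k. m \<ge> N \<Longrightarrow> D (z m) (z (m + k)) < \<epsilon> / C"
      using small[of "\<epsilon> / C"] C(1) by auto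
    have "dist (z m $ i) (z n $ i) < \<epsilon>" if "m \<ge> N" "m < n" for m n
    proof -
      have "C * D (z m) (z n) < \<epsilon>"
        using N[OF that(1), of "n - m"] that(2) C(1) by (simp add: field_simps)
      then show ?thesis by (rule le_less_trans[OF C(2)])
    qed
    then show "\<exists>N. \<forall>m\<ge>N. \<forall>n>m. dist (z m $ i) (z n $ i) < \<epsilon>" by blast
  qed

  \<comment> \<open>The starting tuple may lie outside \<open>E\<close>, hence the shift by one.\<close>
  have tail_E: "z (Suc m) $ i \<in> E" for m i
    using range by (auto simp: z_step[symmetric])
  have "\<exists>l. l \<in> E \<and> (\<lambda>m. z (Suc m) $ i) \<longlonglongrightarrow> l" for i
  proof -
    have "Cauchy (\<lambda>m. z (Suc m) $ i)"
      using Cauchy_subseq_Cauchy[OF cauchy[of i], of Suc] by (simp add: strict_mono_Suc_iff o_def)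
    then show ?thesis
      using complete tail_E orbit_nth[of Suc i] unfolding O_complete_def
      by (simp add: mono_Suc Bex_def)
  qed
  then have "\<exists>l. \<forall>i. l i \<in> E \<and> (\<lambda>m. z (Suc m) $ i) \<longlonglongrightarrow> l i"
    by (intro choice allI)
  then obtain l0 where l0: "\<And>i. l0 i \<in> E" "\<And>i. (\<lambda>m. z (Suc m) $ i) \<longlonglongrightarrow> l0 i"
    by blast
  define l where "l = (\<chi> i. l0 i)"
  have l_E: "l $ i \<in> E" and tail_lim: "(\<lambda>m. z (Suc m) $ i) \<longlonglongrightarrow> l $ i" for i
    using l0 by (simp_all add: l_def)

  have "(\<lambda>m. z (Suc (Suc m)) $ i) \<longlonglongrightarrow> G l $ i" for i
    using cont
  proof
    assume O_cont: "O_continuous F"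
    define u where "u = (\<lambda>k m. z (Suc m) $ star i k)"
    have "\<forall>k. (incseq (u k) \<or> decseq (u k)) \<and> u k \<longlonglongrightarrow> star_tuple star i l $ k"
      using orbit_nth[of Suc] tail_lim by (simp add: u_def star_tuple_def mono_Suc)
    then have "(\<lambda>m. F (\<chi> k. u k m)) \<longlonglongrightarrow> F (star_tuple star i l)"
      using O_cont unfolding O_continuous_def by blast
    then show ?thesis
      by (simp add: u_def star_tuple_def[symmetric] z_step G_def)
  next
    assume MCB: "MCB_property E"
    have limit_comparable: "z (Suc m) \<le> l \<or> z (Suc m) \<ge> l" for m
    proof -
      have bound: "(incseq (\<lambda>m. z (Suc m) $ j) \<longrightarrow> (\<forall>m. z (Suc m) $ j \<le> l $ j)) \<and>
          (decseq (\<lambda>m. z (Suc m) $ j) \<longrightarrow> (\<forall>m. z (Suc m) $ j \<ge> l $ j))" for j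
        using MCB[unfolded MCB_property_def, rule_format, of "\<lambda>m. z (Suc m) $ j" "l $ j"]
          tail_E l_E tail_lim by simp
      show ?thesis
        using orbit
      proof
        assume "incseq z"
        then have "incseq (\<lambda>m. z (Suc m) $ j)" for j
          by (simp add: monotone_def less_eq_vec_def)
        then show ?thesis using bound by (simp add: less_eq_vec_def)
      next
        assume "decseq z"
        then have "decseq (\<lambda>m. z (Suc m) $ j)" for j
          by (simp add: monotone_def less_eq_vec_def)
        then show ?thesis using bound by (simp add: less_eq_vec_def)
      qed
    qed
    have bound: "dist (z (Suc (Suc m)) $ i) (G l $ i)
        \<le> C * (\<Sum>j\<in>UNIV. dist (z (Suc m) $ j) (l $ j))" for m
    proof -
      have "dist (z (Suc (Suc m)) $ i) (G l $ i) \<le> C * D (G (z (Suc m))) (G l)"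
        unfolding z_Suc[of "Suc m"] by (rule C(2))
      also have "\<dots> \<le> C * D (z (Suc m)) l"
        using C(1) nonexp[OF limit_comparable] by simp
      also have "\<dots> \<le> C * (\<Sum>j\<in>UNIV. dist (z (Suc m) $ j) (l $ j))"
        using C(1) D_le by simp
      finally show ?thesis .
    qed
    have "(\<lambda>m. C * (\<Sum>j\<in>UNIV. dist (z (Suc m) $ j) (l $ j))) \<longlonglongrightarrow> C * (\<Sum>j\<in>(UNIV::'n set). 0)"
      using tail_lim by (intro tendsto_mult tendsto_sum tendsto_const) (simp add: tendsto_dist_iff[symmetric])
    then have "(\<lambda>m. C * (\<Sum>j\<in>UNIV. dist (z (Suc m) $ j) (l $ j))) \<longlonglongrightarrow> 0"
      by simp
    then have "(\<lambda>m. dist (z (Suc (Suc m)) $ i) (G l $ i)) \<longlonglongrightarrow> 0"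
      by (rule tendsto_sandwich[OF _ _ tendsto_const, rotated 2]) (simp_all add: bound)
    then show ?thesis by (simp add: tendsto_dist_iff[symmetric])
  qed
  then have "G l $ i = l $ i" for i
    using LIMSEQ_unique LIMSEQ_Suc[OF tail_lim[of i]] by blast
  then show ?thesis
    by (auto simp: vec_eq_iff)
qed

theorem theorem14:
  fixes F :: "'a::{metric_space, order} ^ 'n::finite \<Rightarrow> 'a"
    and star :: "'n \<Rightarrow> 'n \<Rightarrow> 'n"
    and E :: "'a set"
  assumes "CARD('n) \<ge> 2"
    and "E \<noteq> {}" and "O_complete E" and "range F \<subseteq> E"
    and "monotone_property F"
    and "O_continuous F \<or> MCB_property E"
    and "\<exists>x0::'a ^ 'n. (\<forall>i. x0 $ i \<le> F (star_tuple star i x0)) \<or>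
                       (\<forall>i. x0 $ i \<ge> F (star_tuple star i x0))"
    and "(\<exists>\<phi>\<in>Omega. \<forall>x y :: 'a ^ 'n. (\<forall>i. x $ i \<le> y $ i) \<or> (\<forall>i. x $ i \<ge> y $ i) \<longrightarrow>
            1 / real CARD('n) *
              (\<Sum>i\<in>UNIV. dist (F (star_tuple star i x)) (F (star_tuple star i y)))
            \<le> \<phi> (1 / real CARD('n) * (\<Sum>i\<in>UNIV. dist (x $ i) (y $ i))))
       \<or> (\<exists>\<phi>\<in>Omega. \<forall>x y :: 'a ^ 'n. (\<forall>i. x $ i \<le> y $ i) \<or> (\<forall>i. x $ i \<ge> y $ i) \<longrightarrow>
            (MAX i\<in>UNIV. dist (F (star_tuple star i x)) (F (star_tuple star i y)))
            \<le> \<phi> (MAX i\<in>UNIV. dist (x $ i) (y $ i)))"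
  shows "\<exists>x. star_fixed_point star F x"
proof -
  obtain x0 where start: "x0 \<le> star_map star F x0 \<or> x0 \<ge> star_map star F x0"
    using assms(7) by (auto simp: less_eq_vec_def)
  obtain D \<phi> where D: "product_distance D" and \<phi>: "\<phi> \<in> Omega"
    and contraction: "\<And>x y. x \<le> y \<or> x \<ge> y \<Longrightarrow> D (star_map star F x) (star_map star F y) \<le> \<phi> (D x y)"
    using assms(8)
  proof (elim disjE bexE, goal_cases)
    case (1 \<phi>)
    show ?case
      by (rule 1(1)[OF product_distance_average 1(2)], unfold star_map_nth less_eq_vec_def)
        (rule 1(3)[rule_format])
  next
    case (2 \<phi>)
    show ?case
      by (rule 2(1)[OF product_distance_maximum 2(2)], unfold star_map_nth less_eq_vec_def)
        (rule 2(3)[rule_format])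
  qed
  obtain x where "star_map star F x = x"
    using star_map_has_fixed_point[where D = D and \<phi> = \<phi>, OF assms(3-6) start D \<phi> contraction]
    by auto
  then have "star_fixed_point star F x"
    by (auto simp: star_fixed_point_def vec_eq_iff)
  then show ?thesis ..
qed

end
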